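(* Let $\Omega$ be a nonempty open convex subset of $\mathbb{R}^n$. The distance function associated to the reversible tautological weak Finsler structure on $\Omega$ is the Hilbert distance $H_\Omega$. Furthermore, the affine segments in $\Omega$ are minimal paths for the Hilbert metric (that is, for all $x,y\in\Omega$, the length of the affine segment from $x$ to $y$ with respect to the reversible tautological weak Finsler structure equals $H_\Omega(x,y)$).
   Context: **Weak Finsler structures.** A weak Finsler structure on $\Omega$ is a subset $\widetilde{C}\subset T\Omega\simeq\Omega\times\mathbb{R}^n$ each of whose fibers $\widetilde{C}_x\subset T_x\Omega\simeq\mathbb{R}^n$ is convex and contains $0$. Its Lagrangian is $(x,\xi)\mapsto\inf\{t>0\mid t^{-1}\xi\in\widetilde{C}_x\}$. The length of a piecewise $C^1$ path is the integral of the Lagrangian along $(\gamma,\dot\gamma)$, and the associated distance from $x$ to $y$ is the infimum of the lengths of piecewise $C^1$ paths in $\Omega$ from $x$ to $y$. **Tautological structures.** The tautological weak Finsler structure on $\Omega$ is $\widetilde{\Omega}=\{(x,\xi)\mid x\in\Omega,\ x+\xi\in\Omega\}$, so its fiber at $x$ is $\widetilde{\Omega}_x=\Omega-x$. The reversible tautological weak Finsler structure on $\Omega$ is its harmonic symmetrization, whose fiber at $x$ is $\mathcal{H}(\widetilde{\Omega}_x,0)$. **Harmonic symmetrization.** For an open convex set $C\subset\mathbb{R}^n$ containing $0$, $\mathcal{H}(C,0)$ is obtained by replacing, for each line $L$ through $0$, the open interval $L\cap C$ with (possibly infinite) endpoints $a_1,a_2$ by the open interval of $L$ centered at $0$ with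 half-length $\rho\in(0,\infty]$ given by $\frac1\rho=\frac12\left(\frac1{|a_1|}+\frac1{|a_2|}\right)$, where $1/\infty=0$. **Hilbert metric.** For $x\ne y$ in $\Omega$, let $R(x,y)$ be the half-line with origin $x$ through $y$. When $R(x,y)\not\subset\Omega$, let $a^+$ be the unique point of $R(x,y)\cap\partial\Omega$; when $R(y,x)\not\subset\Omega$, let $a^-$ be the unique point of $R(y,x)\cap\partial\Omega$. The Hilbert metric is $$H_\Omega(x,y)=\begin{cases}\frac12\log\left(\frac{|x-a^+|}{|y-a^+|}\cdot\frac{|y-a^-|}{|x-a^-|}\right)&\text{if }x\ne y,\ R(x,y)\not\subset\Omega,\ R(y,x)\not\subset\Omega,\\[4pt] \frac12\log\frac{|x-a^+|}{|y-a^+|}&\text{if }x\ne y,\ R(x,y)\not\subset\Omega,\ R(y,x)\subset\Omega,\\[4pt] \frac12\log\frac{|y-a^-|}{|x-a^-|}&\text{if }x\ne y,\ R(x,y)\subset\Omega,\ R(y,x)\not\subset\Omega,\\[4pt] 0&\text{otherwise.}\end{cases}$$ Equivalently, $H_\Omega(x,y)=\frac12(F_\Omega(x,y)+F_\Omega(y,x))$, where $F_\Omega(x,y)=\log\frac{|x-a^+|}{|y-a^+|}$ if $x\ne y$ and $R(x,y)\not\subset\Omega$, and $F_\Omega(x,y)=0$ otherwise. *)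

theory Defs
  imports "HOL-Analysis.Analysis"
begin

section \<open>Weak Finsler structures\<close>

text \<open>A structure on \<open>\<Omega>\<close> is a set of pairs (base point, tangent vector), i.e. a subset of
  \<open>T\<Omega> = \<Omega> \<times> \<real>\<^sup>n\<close>.\<close>

definition fiber :: "('a \<times> 'b) set \<Rightarrow> 'a \<Rightarrow> 'b set" where
  "fiber C x = {\<xi>. (x, \<xi>) \<in> C}"

definition weak_finsler_structure ::
    "'a::real_normed_vector set \<Rightarrow> ('a \<times> 'a) set \<Rightarrow> bool" where
  "weak_finsler_structure \<Omega> C \<longleftrightarrow>
     C \<subseteq> \<Omega> \<times> UNIV \<and> (\<forall>x\<in>\<Omega>. convex (fiber C x) \<and> 0 \<in> fiber C x)"

text \<open>The value is extended: it is \<open>\<infinity>\<close> if no positive multiple of \<open>\<xi>\<close> lies in the fiber.\<close>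

definition lagrangian :: "('a \<times> 'a::real_normed_vector) set \<Rightarrow> 'a \<Rightarrow> 'a \<Rightarrow> ennreal" where
  "lagrangian C x \<xi> = (INF t\<in>{t::real. t > 0 \<and> inverse t *\<^sub>R \<xi> \<in> fiber C x}. ennreal t)"

text \<open>Paths are parametrized by \<open>[0,1]\<close>, as elsewhere in the library. Between consecutive
  subdivision points the path is \<open>C\<^sup>1\<close> up to and including the endpoints (with one-sided
  derivatives there). This is stronger than \<^const>\<open>piecewise_C1_differentiable_on\<close>, which lets the
  derivative blow up at the subdivision points.\<close>

definition piecewise_C1_path :: "(real \<Rightarrow> 'a::real_normed_vector) \<Rightarrow> bool" where
  "piecewise_C1_path \<gamma> \<longleftrightarrow>
     (\<exists>T. finite T \<and> {0, 1} \<subseteq> T \<and> T \<subseteq> {0..1} \<and>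
        (\<forall>a\<in>T. \<forall>b\<in>T. a < b \<and> T \<inter> {a<..<b} = {} \<longrightarrow>
           (\<exists>\<gamma>'. continuous_on {a..b} \<gamma>' \<and>
              (\<forall>t\<in>{a..b}. (\<gamma> has_vector_derivative \<gamma>' t) (at t within {a..b})))))"

text \<open>The derivative is undetermined only at the finitely many subdivision points, which do not
  contribute to the integral.\<close>

definition finsler_length ::
    "('a \<times> 'a::real_normed_vector) set \<Rightarrow> (real \<Rightarrow> 'a) \<Rightarrow> ennreal" where
  "finsler_length C \<gamma> =
     (\<integral>\<^sup>+ t\<in>{0..1}. lagrangian C (\<gamma> t) (vector_derivative \<gamma> (at t within {0..1})) \<partial>lborel)"

definition finsler_dist ::
    "'a::real_normed_vector set \<Rightarrow> ('a \<times> 'a) set \<Rightarrow> 'a \<Rightarrow> 'a \<Rightarrow> ennreal" where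
  "finsler_dist \<Omega> C x y =
     (INF \<gamma>\<in>{\<gamma>. piecewise_C1_path \<gamma> \<and> path_image \<gamma> \<subseteq> \<Omega> \<and> pathstart \<gamma> = x \<and> pathfinish \<gamma> = y}.
        finsler_length C \<gamma>)"


section \<open>Harmonic symmetrization\<close>

text \<open>For a unit vector \<open>v\<close> spanning the line \<open>L\<close>, the endpoints \<open>a\<^sub>1, a\<^sub>2\<close> of \<open>L \<inter> C\<close> are at
  distance \<open>radius C v\<close> and \<open>radius C (- v)\<close> from \<open>0\<close>. In \<^typ>\<open>ennreal\<close> we have
  \<open>inverse \<infinity> = 0\<close> and \<open>inverse 0 = \<infinity>\<close>.\<close>

definition radius :: "'a::real_normed_vector set \<Rightarrow> 'a \<Rightarrow> ennreal" where
  "radius C v = (SUP t\<in>{t::real. t \<ge> 0 \<and> t *\<^sub>R v \<in> C}. ennreal t)"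

definition harmonic_radius :: "'a::real_normed_vector set \<Rightarrow> 'a \<Rightarrow> ennreal" where
  "harmonic_radius C v = inverse ((inverse (radius C v) + inverse (radius C (- v))) / 2)"

definition harmonic_symmetrization :: "'a::real_normed_vector set \<Rightarrow> 'a set" where
  "harmonic_symmetrization C =
     (\<Union>v\<in>{v. norm v = 1}. {s *\<^sub>R v | s::real. ennreal \<bar>s\<bar> < harmonic_radius C v})"


section \<open>Tautological structures\<close>

definition tautological :: "'a::real_normed_vector set \<Rightarrow> ('a \<times> 'a) set" where
  "tautological \<Omega> = {(x, \<xi>). x \<in> \<Omega> \<and> x + \<xi> \<in> \<Omega>}"

definition reversible_tautological :: "'a::real_normed_vector set \<Rightarrow> ('a \<times> 'a) set" where
  "reversible_tautological \<Omega> =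
     {(x, \<xi>). x \<in> \<Omega> \<and> \<xi> \<in> harmonic_symmetrization (fiber (tautological \<Omega>) x)}"

lemma less_radius_iff:
  fixes C :: "'a::real_normed_vector set"
  assumes "open C" "convex C" "0 \<in> C" "s \<ge> 0"
  shows "ennreal s < radius C v \<longleftrightarrow> s *\<^sub>R v \<in> C"
proof
  assume "ennreal s < radius C v"
  then obtain t where t: "t \<ge> 0" "t *\<^sub>R v \<in> C" "s < t"
    unfolding radius_def less_SUP_iff using assms(4) by (auto simp: ennreal_less_iff)
  have "(s / t) *\<^sub>R (t *\<^sub>R v) + (1 - s / t) *\<^sub>R 0 \<in> C"
    using t assms by (intro convexD) auto
  with t assms(4) show "s *\<^sub>R v \<in> C" by simp
next
  assume "s *\<^sub>R v \<in> C"
  moreover have "open ((\<lambda>t. t *\<^sub>R v) -` C)"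
    by (intro open_vimage assms continuous_intros)
  ultimately obtain e where e: "e > 0" "ball s e \<subseteq> (\<lambda>t. t *\<^sub>R v) -` C"
    by (meson open_contains_ball vimageI2)
  then have "(s + e / 2) *\<^sub>R v \<in> C" by (auto simp: subset_iff dist_real_def)
  then have "ennreal (s + e / 2) \<le> radius C v"
    unfolding radius_def using assms(4) e by (intro SUP_upper) auto
  moreover have "ennreal s < ennreal (s + e / 2)"
    using e assms(4) by (simp add: ennreal_less_iff)
  ultimately show "ennreal s < radius C v" by (rule order_less_le_trans[rotated])
qed

lemma less_harmonic_radius_iff:
  fixes C :: "'a::real_normed_vector set"
  assumes C: "open C" "convex C" "0 \<in> C" and s: "s \<ge> 0"
  shows "ennreal s < harmonic_radius C v \<longleftrightarrow>
    (\<exists>a b. a > 0 \<and> b > 0 \<and> a + b = 2 \<and> (s / a) *\<^sub>R v \<in> C \<and> (s / b) *\<^sub>R (- v) \<in> C)"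
proof -
  have less_inverse: "ennreal u < inverse (ennreal \<alpha>) \<longleftrightarrow> u * \<alpha> < 1"
    if "u \<ge> 0" "\<alpha> \<ge> 0" for u \<alpha> :: real
  proof (cases "\<alpha> = 0")
    case False
    with that show ?thesis
      by (simp add: inverse_ennreal ennreal_less_iff field_simps)
  qed simp
  have "\<exists>\<alpha>\<ge>0. radius C w = inverse (ennreal \<alpha>)" for w
  proof (cases "radius C w")
    case (real r)
    have "r > 0" using less_radius_iff[OF C, of 0 w] C(3) real by simp
    then show ?thesis using real by (intro exI[of _ "inverse r"]) (simp add: inverse_ennreal)
  next
    case top
    then show ?thesis by (intro exI[of _ 0]) simp
  qed
  then obtain \<alpha> \<beta> where \<alpha>: "\<alpha> \<ge> 0" "radius C v = inverse (ennreal \<alpha>)"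
    and \<beta>: "\<beta> \<ge> 0" "radius C (- v) = inverse (ennreal \<beta>)" by metis
  have inv_inv: "inverse (inverse (ennreal u)) = ennreal u" if "u \<ge> 0" for u
    using that by (cases "u = 0") (simp_all add: inverse_ennreal)
  have "harmonic_radius C v = inverse (ennreal ((\<alpha> + \<beta>) / 2))"
    using \<alpha> \<beta> by (simp add: harmonic_radius_def inv_inv flip: ennreal_plus divide_ennreal_def)
      (metis add_nonneg_nonneg divide_ennreal ennreal_numeral zero_less_numeral)
  then have 1: "ennreal s < harmonic_radius C v \<longleftrightarrow> s * ((\<alpha> + \<beta>) / 2) < 1"
    using less_inverse[of s "(\<alpha> + \<beta>) / 2"] \<alpha> \<beta> s by simp
  have 2: "(s / a) *\<^sub>R v \<in> C \<longleftrightarrow> s * \<alpha> < a" "(s / a) *\<^sub>R (- v) \<in> C \<longleftrightarrow> s * \<beta> < a" if "a > 0" for a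
    using less_radius_iff[OF C, of "s / a" v] less_radius_iff[OF C, of "s / a" "- v"]
      less_inverse[of "s / a" \<alpha>] less_inverse[of "s / a" \<beta>] \<alpha> \<beta> s that
    by (simp_all add: field_simps)
  show ?thesis
  proof
    assume "ennreal s < harmonic_radius C v"
    then have d: "s * \<alpha> + s * \<beta> < 2" using 1 by (simp add: field_simps)
    define e where "e = (2 - s * \<alpha> - s * \<beta>) / 2"
    have "e > 0" "s * \<alpha> \<ge> 0" "s * \<beta> \<ge> 0" using d s \<alpha> \<beta> by (auto simp: e_def)
    then show "\<exists>a b. a > 0 \<and> b > 0 \<and> a + b = 2 \<and> (s / a) *\<^sub>R v \<in> C \<and> (s / b) *\<^sub>R (- v) \<in> C"
      using 2[of "s * \<alpha> + e"] 2[of "s * \<beta> + e"]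
      by (intro exI[of _ "s * \<alpha> + e"] exI[of _ "s * \<beta> + e"]) (auto simp: e_def field_simps)
  next
    assume "\<exists>a b. a > 0 \<and> b > 0 \<and> a + b = 2 \<and> (s / a) *\<^sub>R v \<in> C \<and> (s / b) *\<^sub>R (- v) \<in> C"
    then obtain a b where "a > 0" "b > 0" "a + b = 2" "s * \<alpha> < a" "s * \<beta> < b"
      using 2 by blast
    then show "ennreal s < harmonic_radius C v" using 1 by (simp add: field_simps)
  qed
qed

lemma harmonic_symmetrization_iff:
  fixes C :: "'a::euclidean_space set"
  assumes C: "open C" "convex C" "0 \<in> C"
  shows "\<xi> \<in> harmonic_symmetrization C \<longleftrightarrow>
    (\<exists>a b. a > 0 \<and> b > 0 \<and> a + b = 2 \<and> inverse a *\<^sub>R \<xi> \<in> C \<and> inverse b *\<^sub>R (- \<xi>) \<in> C)"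
    (is "_ \<longleftrightarrow> ?R")
proof -
  have polar: "ennreal s < harmonic_radius C v \<longleftrightarrow> ?R" if "s \<ge> 0" "\<xi> = s *\<^sub>R v" for s v
    using less_harmonic_radius_iff[OF C that(1), of v] that(2) by (simp add: field_simps)
  show ?thesis
  proof
    assume "\<xi> \<in> harmonic_symmetrization C"
    then obtain v s where s: "\<xi> = s *\<^sub>R v" "ennreal \<bar>s\<bar> < harmonic_radius C v"
      by (auto simp: harmonic_symmetrization_def)
    have "harmonic_radius C (- v) = harmonic_radius C v"
      by (simp add: harmonic_radius_def add.commute)
    with s polar[of "\<bar>s\<bar>" v] polar[of "\<bar>s\<bar>" "- v"] show ?R
      by (cases "s \<ge> 0") auto
  next
    assume R: ?R
    have "\<exists>v. norm v = 1 \<and> \<xi> = norm \<xi> *\<^sub>R v"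
    proof (cases "\<xi> = 0")
      case True
      then show ?thesis using vector_choose_size[of 1] by auto
    next
      case False
      then show ?thesis by (intro exI[of _ "inverse (norm \<xi>) *\<^sub>R \<xi>"]) simp
    qed
    then obtain v where v: "norm v = 1" "\<xi> = norm \<xi> *\<^sub>R v" by blast
    with polar[of "norm \<xi>" v] R have "ennreal \<bar>norm \<xi>\<bar> < harmonic_radius C v" by simp
    with v show "\<xi> \<in> harmonic_symmetrization C"
      unfolding harmonic_symmetrization_def by blast
  qed
qed

lemma convex_harmonic_symmetrization:
  fixes C :: "'a::euclidean_space set"
  assumes C: "open C" "convex C" "0 \<in> C"
  shows "convex (harmonic_symmetrization C)"
proof (rule convexI)
  have mix: "inverse (u * a + w * b) *\<^sub>R (u *\<^sub>R \<xi> + w *\<^sub>R \<eta>) \<in> C"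
    if "a > 0" "b > 0" "u \<ge> 0" "w \<ge> 0" "u + w = 1" "inverse a *\<^sub>R \<xi> \<in> C" "inverse b *\<^sub>R \<eta> \<in> C"
    for u w a b :: real and \<xi> \<eta>
  proof -
    define d where "d = u * a + w * b"
    have d: "d > 0"
      unfolding d_def using that
      by (metis add_nonneg_eq_0_iff add_nonneg_nonneg less_eq_real_def mult_eq_0_iff
          mult_nonneg_nonneg not_less zero_neq_one)
    have "(u * a / d) *\<^sub>R (inverse a *\<^sub>R \<xi>) + (w * b / d) *\<^sub>R (inverse b *\<^sub>R \<eta>) \<in> C"
      using that d by (intro convexD[OF C(2)]) (auto simp: d_def simp flip: add_divide_distrib)
    moreover have "(u * a / d) *\<^sub>R (inverse a *\<^sub>R \<xi>) = inverse d *\<^sub>R (u *\<^sub>R \<xi>)"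
      "(w * b / d) *\<^sub>R (inverse b *\<^sub>R \<eta>) = inverse d *\<^sub>R (w *\<^sub>R \<eta>)"
      using that by (simp_all add: divide_inverse)
    ultimately show ?thesis
      by (simp only: d_def[symmetric] scaleR_add_right)
  qed
  fix \<xi> \<eta> and u w :: real
  assume H: "\<xi> \<in> harmonic_symmetrization C" "\<eta> \<in> harmonic_symmetrization C"
    and u: "u \<ge> 0" "w \<ge> 0" "u + w = 1"
  obtain a b where ab: "a > 0" "b > 0" "a + b = 2" "inverse a *\<^sub>R \<xi> \<in> C" "inverse b *\<^sub>R (- \<xi>) \<in> C"
    using H(1) unfolding harmonic_symmetrization_iff[OF C] by blast
  obtain c d where cd: "c > 0" "d > 0" "c + d = 2" "inverse c *\<^sub>R \<eta> \<in> C" "inverse d *\<^sub>R (- \<eta>) \<in> C"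
    using H(2) unfolding harmonic_symmetrization_iff[OF C] by blast
  have "u * a + w * c > 0" "u * b + w * d > 0"
    using ab cd u by (smt (verit) mult_nonneg_nonneg mult_pos_pos)+
  moreover have "(u * a + w * c) + (u * b + w * d) = 2"
  proof -
    have "(u * a + w * c) + (u * b + w * d) = u * (a + b) + w * (c + d)" by (simp add: algebra_simps)
    then show ?thesis using ab cd u by simp
  qed
  moreover have "- (u *\<^sub>R \<xi> + w *\<^sub>R \<eta>) = u *\<^sub>R (- \<xi>) + w *\<^sub>R (- \<eta>)" by simp
  ultimately show "u *\<^sub>R \<xi> + w *\<^sub>R \<eta> \<in> harmonic_symmetrization C"
    unfolding harmonic_symmetrization_iff[OF C] using mix[OF _ _ u] ab cd by metis
qed

lemma weak_finsler_structure_reversible_tautological: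
  fixes \<Omega> :: "'a::euclidean_space set"
  assumes "open \<Omega>" "convex \<Omega>"
  shows "weak_finsler_structure \<Omega> (reversible_tautological \<Omega>)"
proof -
  have "convex (fiber (reversible_tautological \<Omega>) x) \<and> 0 \<in> fiber (reversible_tautological \<Omega>) x"
    if x: "x \<in> \<Omega>" for x
  proof -
    let ?C = "fiber (tautological \<Omega>) x"
    have "?C = (\<lambda>y. y - x) ` \<Omega>"
      using x by (force simp: fiber_def tautological_def image_iff algebra_simps)
    then have C: "open ?C" "convex ?C" "0 \<in> ?C"
      using assms x by (auto simp: open_translation_subtract)
    have "0 \<in> harmonic_symmetrization ?C"
      unfolding harmonic_symmetrization_iff[OF C] using C(3) by (intro exI[of _ 1]) simp
    moreover have "fiber (reversible_tautological \<Omega>) x = harmonic_symmetrization ?C"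
      using x by (auto simp: fiber_def reversible_tautological_def)
    ultimately show ?thesis using convex_harmonic_symmetrization[OF C] by simp
  qed
  then show ?thesis
    by (auto simp: weak_finsler_structure_def reversible_tautological_def)
qed


section \<open>The Hilbert metric\<close>

definition half_line :: "'a::real_vector \<Rightarrow> 'a \<Rightarrow> 'a set" where
  "half_line x y = {x + t *\<^sub>R (y - x) | t::real. t \<ge> 0}"

text \<open>Meaningful when \<open>\<Omega>\<close> is open and convex, \<open>x, y \<in> \<Omega>\<close> are distinct and
  \<open>half_line x y\<close> is not contained in \<open>\<Omega>\<close>; then the point is unique.\<close>

definition exit_point :: "'a::real_normed_vector set \<Rightarrow> 'a \<Rightarrow> 'a \<Rightarrow> 'a" where
  "exit_point \<Omega> x y = (THE a. a \<in> half_line x y \<inter> frontier \<Omega>)"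

definition hilbert_metric :: "'a::real_normed_vector set \<Rightarrow> 'a \<Rightarrow> 'a \<Rightarrow> real" where
  "hilbert_metric \<Omega> x y =
     (let p = exit_point \<Omega> x y; m = exit_point \<Omega> y x in
      if x \<noteq> y \<and> \<not> half_line x y \<subseteq> \<Omega> \<and> \<not> half_line y x \<subseteq> \<Omega> then
        1 / 2 * ln (norm (x - p) / norm (y - p) * (norm (y - m) / norm (x - m)))
      else if x \<noteq> y \<and> \<not> half_line x y \<subseteq> \<Omega> \<and> half_line y x \<subseteq> \<Omega> then
        1 / 2 * ln (norm (x - p) / norm (y - p))
      else if x \<noteq> y \<and> half_line x y \<subseteq> \<Omega> \<and> \<not> half_line y x \<subseteq> \<Omega> then
        1 / 2 * ln (norm (y - m) / norm (x - m))
      else 0)"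

end

theory Submission
  imports Defs
begin

text \<open>Let \<open>r(x, v) = exit_rate \<Omega> x v\<close> be the reciprocal of the time at which the motion
  \<open>t \<mapsto> x + t v\<close> leaves \<open>\<Omega>\<close> (zero if it never does); this is the Minkowski functional of
  \<open>\<Omega> - x\<close>, that is, the Lagrangian of the tautological structure. Taking harmonic means of radii
  amounts to taking arithmetic means of their reciprocals, so the reversible tautological Lagrangian
  is \<open>(r(x, v) + r(x, - v)) / 2\<close> (\<open>lagrangian_reversible_tautological\<close>). Correspondingly the
  Hilbert metric is the mean of the Funk metric \<open>F(x, y) = - ln (1 - r(x, y - x))\<close> in the two
  directions (\<open>hilbert_metric_eq_funk\<close>). With \<open>r = 0\<close> standing for a ray that stays in \<open>\<Omega>\<close>, these
  formulas cover rays with and without an exit point alike.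

  The length of a segment is an explicit integral: moving from \<open>x\<close> to \<open>x + t v\<close> shortens the time
  left before the exit by \<open>t\<close>, so \<open>r(x + t v, v) = r / (1 - t r)\<close> with \<open>r = r(x, v)\<close>, and the
  integral of this over \<open>[0, 1]\<close> is \<open>- ln (1 - r)\<close> (\<open>finsler_length_linepath\<close>).

  No path is shorter, by calibration. A hyperplane \<open>f = c\<close> that bounds \<open>\<Omega>\<close> and passes through the
  exit point of the ray from \<open>x\<close> through \<open>y\<close> makes \<open>- ln (c - f)\<close> a potential whose derivative in
  the direction \<open>v\<close> is at most \<open>r(z, v)\<close> at every point \<open>z\<close> of \<open>\<Omega>\<close>
  (\<open>exit_rate_ge_functional\<close>), while its increment from \<open>x\<close> to \<open>y\<close> is exactly \<open>F(x, y)\<close>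
  (\<open>supporting_functional\<close>). If the ray stays in \<open>\<Omega>\<close>, then \<open>F(x, y) = 0\<close> and a constant
  potential serves. Averaging this potential with the one for the reverse ray and
  integrating along a path from \<open>x\<close> to \<open>y\<close> bounds its length below by the Hilbert distance
  (\<open>hilbert_metric_le_finsler_length\<close>).\<close>

section \<open>Exit rates\<close>

definition exit_rate :: "'a::real_normed_vector set \<Rightarrow> 'a \<Rightarrow> 'a \<Rightarrow> real" where
  "exit_rate \<Omega> x v = Inf {t. t > 0 \<and> x + inverse t *\<^sub>R v \<in> \<Omega>}"

lemma open_step:
  fixes \<Omega> :: "'a::real_normed_vector set"
  assumes "open \<Omega>" "x \<in> \<Omega>"
  obtains e where "e > 0" "x + e *\<^sub>R v \<in> \<Omega>"
proof -
  have "((\<lambda>e. x + e *\<^sub>R v) \<longlongrightarrow> x + 0 *\<^sub>R v) (at_right 0)"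
    by (intro tendsto_intros)
  then have "\<forall>\<^sub>F e in at_right 0. x + e *\<^sub>R v \<in> \<Omega>"
    using assms by (intro topological_tendstoD) auto
  moreover have "\<forall>\<^sub>F e in at_right 0. e > (0::real)" by (rule eventually_at_right_less)
  ultimately have "\<forall>\<^sub>F e in at_right 0. e > 0 \<and> x + e *\<^sub>R v \<in> \<Omega>"
    by (simp add: eventually_conj_iff)
  then show thesis
    using that eventually_happens'[OF trivial_limit_at_right_real] by blast
qed

lemma exit_rate_nonneg:
  fixes \<Omega> :: "'a::real_normed_vector set"
  assumes "open \<Omega>" "x \<in> \<Omega>"
  shows "exit_rate \<Omega> x v \<ge> 0"
proof -
  obtain e where "e > 0" "x + e *\<^sub>R v \<in> \<Omega>" using open_step[OF assms] by blast
  then have "inverse e \<in> {t. t > 0 \<and> x + inverse t *\<^sub>R v \<in> \<Omega>}" by simp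
  then have "{t. t > 0 \<and> x + inverse t *\<^sub>R v \<in> \<Omega>} \<noteq> {}" by blast
  then show ?thesis
    unfolding exit_rate_def by (rule cInf_greatest) simp
qed

text \<open>Convexity makes the set of admissible \<open>t\<close> in the definition of \<^const>\<open>exit_rate\<close> an up-set,
  and openness of \<open>\<Omega>\<close> excludes its infimum. Together with nonnegativity, this equivalence
  determines the exit rate.\<close>

lemma mem_iff_exit_rate_less:
  fixes \<Omega> :: "'a::real_normed_vector set"
  assumes \<Omega>: "open \<Omega>" "convex \<Omega>" and x: "x \<in> \<Omega>" and t: "t > 0"
  shows "x + inverse t *\<^sub>R v \<in> \<Omega> \<longleftrightarrow> exit_rate \<Omega> x v < t"
proof -
  let ?S = "{t. t > 0 \<and> x + inverse t *\<^sub>R v \<in> \<Omega>}"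
  have bdd: "bdd_below ?S" by (rule bdd_belowI[of _ 0]) auto
  obtain e0 where "e0 > 0" "x + e0 *\<^sub>R v \<in> \<Omega>" using open_step[OF \<Omega>(1) x] by blast
  then have "inverse e0 \<in> ?S" by simp
  then have ne: "?S \<noteq> {}" by blast
  show ?thesis
  proof
    assume "x + inverse t *\<^sub>R v \<in> \<Omega>"
    then obtain e where "e > 0" "x + inverse t *\<^sub>R v + e *\<^sub>R v \<in> \<Omega>"
      using open_step[OF \<Omega>(1)] by blast
    then have e: "e > 0" "x + (inverse t + e) *\<^sub>R v \<in> \<Omega>" by (simp_all add: algebra_simps)
    have pos: "inverse t + e > 0" using e t by (simp add: add_pos_pos)
    then have "inverse (inverse t + e) \<in> ?S" using e by simp
    then have "exit_rate \<Omega> x v \<le> inverse (inverse t + e)"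
      unfolding exit_rate_def by (intro cInf_lower bdd)
    also have "\<dots> < inverse (inverse t)" using e t by (intro less_imp_inverse_less) auto
    finally show "exit_rate \<Omega> x v < t" by simp
  next
    assume "exit_rate \<Omega> x v < t"
    then obtain u where u: "u > 0" "x + inverse u *\<^sub>R v \<in> \<Omega>" "u < t"
      unfolding exit_rate_def cInf_less_iff[OF ne bdd] by blast
    have "(1 - u / t) *\<^sub>R x + (u / t) *\<^sub>R (x + inverse u *\<^sub>R v) \<in> \<Omega>"
      using u t by (intro convexD \<Omega> x) auto
    moreover have "(1 - u / t) *\<^sub>R x + (u / t) *\<^sub>R (x + inverse u *\<^sub>R v) = x + inverse t *\<^sub>R v"
      using u by (simp add: algebra_simps divide_inverse)
    ultimately show "x + inverse t *\<^sub>R v \<in> \<Omega>" by simp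
  qed
qed

text \<open>If the ray from \<open>x\<close> leaves \<open>\<Omega>\<close> at time \<open>1 / r\<close>, then the ray from \<open>x + s v\<close> leaves it at time
  \<open>1 / r - s\<close>, whose reciprocal is \<open>r / (1 - s r)\<close>; this form also makes sense for \<open>r = 0\<close>.\<close>

lemma exit_rate_along_line:
  fixes \<Omega> :: "'a::real_normed_vector set"
  assumes \<Omega>: "open \<Omega>" "convex \<Omega>" and x: "x \<in> \<Omega>"
    and s: "s \<ge> 0" "x + s *\<^sub>R v \<in> \<Omega>"
  shows "s * exit_rate \<Omega> x v < 1"
    and "exit_rate \<Omega> (x + s *\<^sub>R v) v = exit_rate \<Omega> x v / (1 - s * exit_rate \<Omega> x v)"
proof -
  define p where "p = exit_rate \<Omega> x v"
  define q where "q = exit_rate \<Omega> (x + s *\<^sub>R v) v"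
  have p: "p \<ge> 0" and q: "q \<ge> 0" using exit_rate_nonneg \<Omega>(1) x s(2) by (auto simp: p_def q_def)
  show sp: "s * exit_rate \<Omega> x v < 1"
  proof (cases "s = 0")
    case False
    then have "exit_rate \<Omega> x v < inverse s"
      using mem_iff_exit_rate_less[OF \<Omega> x, of "inverse s" v] s by simp
    with False s show ?thesis by (simp add: field_simps)
  qed simp
  have eq: "q < t \<longleftrightarrow> p / (1 - s * p) < t" if t: "t > 0" for t
  proof -
    have pos: "s + inverse t > 0" using s t by (simp add: add_nonneg_pos)
    have "q < t \<longleftrightarrow> x + inverse (inverse (s + inverse t)) *\<^sub>R v \<in> \<Omega>"
      using mem_iff_exit_rate_less[OF \<Omega> s(2) t, of v] by (simp add: q_def algebra_simps)
    also have "\<dots> \<longleftrightarrow> p < inverse (s + inverse t)"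
      using mem_iff_exit_rate_less[OF \<Omega> x, of "inverse (s + inverse t)" v] pos
      by (simp add: p_def)
    also have "\<dots> \<longleftrightarrow> p / (1 - s * p) < t"
    proof -
      have "p < inverse (s + inverse t) \<longleftrightarrow> p * (s + inverse t) < 1"
        using pos by (simp add: field_simps)
      also have "\<dots> \<longleftrightarrow> p < t * (1 - s * p)"
        using t by (simp add: field_simps)
      also have "\<dots> \<longleftrightarrow> p / (1 - s * p) < t"
        using sp by (simp add: p_def pos_divide_less_eq)
      finally show ?thesis .
    qed
    finally show ?thesis .
  qed
  have r: "p / (1 - s * p) \<ge> 0" using p sp by (simp add: p_def)
  have "q = p / (1 - s * p)"
    using eq[of q] eq[of "p / (1 - s * p)"] q r by (meson less_irrefl linorder_neqE_linordered_idom order_le_less_trans)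
  then show "exit_rate \<Omega> (x + s *\<^sub>R v) v = exit_rate \<Omega> x v / (1 - s * exit_rate \<Omega> x v)"
    by (simp add: p_def q_def)
qed

text \<open>The vector \<open>v / t\<close> lies in the harmonic symmetrization iff \<open>2 t\<close> can be split as \<open>A + B\<close> with
  \<open>A\<close> above the exit rate of \<open>v\<close> and \<open>B\<close> above that of \<open>- v\<close>, i.e. iff \<open>2 t\<close> exceeds the sum of the
  two rates.\<close>

lemma lagrangian_reversible_tautological:
  fixes \<Omega> :: "'a::euclidean_space set"
  assumes \<Omega>: "open \<Omega>" "convex \<Omega>" and x: "x \<in> \<Omega>"
  shows "lagrangian (reversible_tautological \<Omega>) x v
    = ennreal ((exit_rate \<Omega> x v + exit_rate \<Omega> x (- v)) / 2)"
proof -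
  define p where "p = exit_rate \<Omega> x v"
  define q where "q = exit_rate \<Omega> x (- v)"
  have p: "p \<ge> 0" and q: "q \<ge> 0" using exit_rate_nonneg \<Omega>(1) x by (auto simp: p_def q_def)
  let ?C = "fiber (tautological \<Omega>) x"
  have C_iff: "\<xi> \<in> ?C \<longleftrightarrow> x + \<xi> \<in> \<Omega>" for \<xi> using x by (simp add: fiber_def tautological_def)
  have "?C = (\<lambda>y. y - x) ` \<Omega>"
    by (force simp: C_iff image_iff algebra_simps)
  then have C: "open ?C" "convex ?C" "0 \<in> ?C"
    using \<Omega> x by (auto simp: open_translation_subtract)
  have "inverse t *\<^sub>R v \<in> fiber (reversible_tautological \<Omega>) x \<longleftrightarrow> (p + q) / 2 < t"
    if t: "t > 0" for t
  proof -
    have mem: "inverse t *\<^sub>R v \<in> fiber (reversible_tautological \<Omega>) x \<longleftrightarrow>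
        (\<exists>a b. a > 0 \<and> b > 0 \<and> a + b = 2 \<and> p < a * t \<and> q < b * t)"
    proof -
      have "inverse a *\<^sub>R inverse t *\<^sub>R v \<in> ?C \<longleftrightarrow> p < a * t"
        "inverse a *\<^sub>R (- (inverse t *\<^sub>R v)) \<in> ?C \<longleftrightarrow> q < a * t" if "a > 0" for a
        using mem_iff_exit_rate_less[OF \<Omega> x, of "a * t" v]
          mem_iff_exit_rate_less[OF \<Omega> x, of "a * t" "- v"] t that
        by (simp_all add: C_iff p_def q_def)
      moreover have "inverse t *\<^sub>R v \<in> fiber (reversible_tautological \<Omega>) x \<longleftrightarrow>
          inverse t *\<^sub>R v \<in> harmonic_symmetrization ?C"
        using x by (simp add: fiber_def reversible_tautological_def)
      ultimately show ?thesis
        unfolding harmonic_symmetrization_iff[OF C] by (metis (no_types, lifting))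
    qed
    show ?thesis
    proof
      assume "inverse t *\<^sub>R v \<in> fiber (reversible_tautological \<Omega>) x"
      then obtain a b where ab: "a + b = 2" "p < a * t" "q < b * t" using mem by blast
      have "p + q < a * t + b * t" using ab by linarith
      also have "\<dots> = (a + b) * t" by (simp add: distrib_right)
      finally show "(p + q) / 2 < t" using ab by simp
    next
      assume less: "(p + q) / 2 < t"
      \<comment> \<open>The surplus \<open>2 t - (p + q)\<close> is shared equally between the two directions.\<close>
      define e where "e = t - (p + q) / 2"
      have e: "e > 0" using less by (simp add: e_def)
      have "(p + e) / t + (q + e) / t = 2"
        using t by (simp add: e_def field_simps)
      then show "inverse t *\<^sub>R v \<in> fiber (reversible_tautological \<Omega>) x"
        unfolding mem using p q e t
        by (intro exI[of _ "(p + e) / t"] exI[of _ "(q + e) / t"]) simp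
    qed
  qed
  then have S: "{t. t > 0 \<and> inverse t *\<^sub>R v \<in> fiber (reversible_tautological \<Omega>) x} = {(p + q) / 2<..}"
    using p q by (auto intro: order_le_less_trans[rotated])
  have "(INF t\<in>{(p + q) / 2<..}. ennreal t) = ennreal ((p + q) / 2)"
  proof (rule antisym)
    show "(INF t\<in>{(p + q) / 2<..}. ennreal t) \<le> ennreal ((p + q) / 2)"
    proof (rule ennreal_le_epsilon)
      fix e :: real
      assume e: "e > 0"
      then have "(INF t\<in>{(p + q) / 2<..}. ennreal t) \<le> ennreal ((p + q) / 2 + e)"
        by (intro INF_lower) simp
      also have "\<dots> = ennreal ((p + q) / 2) + ennreal e"
        using p q e by (simp add: ennreal_plus)
      finally show "(INF t\<in>{(p + q) / 2<..}. ennreal t) \<le> ennreal ((p + q) / 2) + ennreal e" .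
    qed
    show "ennreal ((p + q) / 2) \<le> (INF t\<in>{(p + q) / 2<..}. ennreal t)"
      by (intro INF_greatest ennreal_leI) simp
  qed
  then show ?thesis unfolding lagrangian_def S p_def q_def .
qed

section \<open>The Funk metric\<close>

text \<open>The usual expression \<open>ln (|x - a| / |y - a|)\<close>, with \<open>a\<close> the exit point of the ray from \<open>x\<close>
  through \<open>y\<close>, is recovered in \<open>funk_eq_ln_ratio\<close>. The form chosen here is defined also when the
  ray has no exit point.\<close>

definition funk :: "'a::real_normed_vector set \<Rightarrow> 'a \<Rightarrow> 'a \<Rightarrow> real" where
  "funk \<Omega> x y = - ln (1 - exit_rate \<Omega> x (y - x))"

lemma exit_rate_chord_less_one:
  fixes \<Omega> :: "'a::real_normed_vector set"
  assumes "open \<Omega>" "convex \<Omega>" "x \<in> \<Omega>" "y \<in> \<Omega>"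
  shows "exit_rate \<Omega> x (y - x) < 1"
  using exit_rate_along_line(1)[OF assms(1-3), of 1 "y - x"] assms(4) by simp

lemma funk_nonneg:
  fixes \<Omega> :: "'a::real_normed_vector set"
  assumes "open \<Omega>" "convex \<Omega>" "x \<in> \<Omega>" "y \<in> \<Omega>"
  shows "funk \<Omega> x y \<ge> 0"
  using exit_rate_nonneg[OF assms(1,3), of "y - x"] exit_rate_chord_less_one[OF assms]
  by (simp add: funk_def)

lemma half_line_subset_iff:
  fixes \<Omega> :: "'a::real_normed_vector set"
  assumes \<Omega>: "open \<Omega>" "convex \<Omega>" and x: "x \<in> \<Omega>"
  shows "half_line x y \<subseteq> \<Omega> \<longleftrightarrow> exit_rate \<Omega> x (y - x) = 0"
proof
  assume sub: "half_line x y \<subseteq> \<Omega>"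
  have "exit_rate \<Omega> x (y - x) < t" if "t > 0" for t
  proof -
    have "x + inverse t *\<^sub>R (y - x) \<in> half_line x y"
      using that unfolding half_line_def by (intro CollectI exI[of _ "inverse t"]) simp
    with sub show ?thesis using mem_iff_exit_rate_less[OF \<Omega> x that] by blast
  qed
  then show "exit_rate \<Omega> x (y - x) = 0"
    using exit_rate_nonneg[OF \<Omega>(1) x, of "y - x"]
    by (metis less_irrefl order_le_imp_less_or_eq)
next
  assume 0: "exit_rate \<Omega> x (y - x) = 0"
  have "x + t *\<^sub>R (y - x) \<in> \<Omega>" if "t \<ge> 0" for t
    using mem_iff_exit_rate_less[OF \<Omega> x, of "inverse t" "y - x"] 0 x that
    by (cases "t = 0") auto
  then show "half_line x y \<subseteq> \<Omega>" by (auto simp: half_line_def)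
qed

text \<open>The ray meets the frontier only once: up to time \<open>1 / exit_rate\<close> it runs in the open set
  \<open>\<Omega>\<close>, and a point of \<open>closure \<Omega>\<close> beyond that time would, together with the interior point \<open>x\<close>,
  force the exit point itself into \<open>\<Omega>\<close>.\<close>

lemma exit_point_eq:
  fixes \<Omega> :: "'a::euclidean_space set"
  assumes \<Omega>: "open \<Omega>" "convex \<Omega>" and x: "x \<in> \<Omega>" and pos: "exit_rate \<Omega> x (y - x) > 0"
  shows "exit_point \<Omega> x y = x + inverse (exit_rate \<Omega> x (y - x)) *\<^sub>R (y - x)"
proof -
  define p where "p = exit_rate \<Omega> x (y - x)"
  define a where "a = x + inverse p *\<^sub>R (y - x)"
  have p: "p > 0" using pos by (simp add: p_def)
  have inside: "x + t *\<^sub>R (y - x) \<in> \<Omega>" if "t \<ge> 0" "t < inverse p" for t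
    using mem_iff_exit_rate_less[OF \<Omega> x, of "inverse t" "y - x"] x that p
    by (cases "t = 0") (auto simp: p_def field_simps)
  have out: "a \<notin> \<Omega>"
    using mem_iff_exit_rate_less[OF \<Omega> x p, of "y - x"] by (simp add: a_def p_def)
  have int: "interior \<Omega> = \<Omega>" using \<Omega>(1) by (rule interior_open)
  have "((\<lambda>t. x + t *\<^sub>R (y - x)) \<longlongrightarrow> a) (at_left (inverse p))"
    unfolding a_def by (intro tendsto_intros)
  moreover have "\<forall>\<^sub>F t in at_left (inverse p). x + t *\<^sub>R (y - x) \<in> \<Omega>"
    using p by (intro eventually_at_leftI[of 0]) (auto intro: inside)
  then have "\<forall>\<^sub>F t in at_left (inverse p). x + t *\<^sub>R (y - x) \<in> closure \<Omega>"
    by (rule eventually_mono) (use closure_subset in blast)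
  ultimately have "a \<in> closure \<Omega>"
    by (intro Lim_in_closed_set[OF closed_closure _ trivial_limit_at_left_real])
  then have a: "a \<in> half_line x y \<inter> frontier \<Omega>"
    using out p unfolding frontier_def int half_line_def a_def
    by (intro IntI CollectI exI[of _ "inverse p"]) auto
  have uniq: "b = a" if "b \<in> half_line x y \<inter> frontier \<Omega>" for b
  proof -
    obtain t where t: "t \<ge> 0" "b = x + t *\<^sub>R (y - x)" using \<open>b \<in> _\<close> by (auto simp: half_line_def)
    have b: "b \<notin> \<Omega>" "b \<in> closure \<Omega>" using \<open>b \<in> _\<close> by (auto simp: frontier_def int)
    have "\<not> inverse p < t"
    proof
      assume less: "inverse p < t"
      have "x \<noteq> b" using b x by blast
      moreover have "a = (1 - inverse p / t) *\<^sub>R x + (inverse p / t) *\<^sub>R b"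
      proof -
        have "t \<noteq> 0" using less p by (metis inverse_positive_iff_positive less_asym)
        then have "(inverse p / t) *\<^sub>R b = (inverse p / t) *\<^sub>R x + inverse p *\<^sub>R (y - x)"
          by (simp add: t(2) scaleR_add_right)
        then show ?thesis by (simp add: a_def algebra_simps)
      qed
      moreover have "inverse p > 0" using p by simp
      then have "0 < inverse p / t" "inverse p / t < 1"
        using less by (auto simp del: inverse_positive_iff_positive)
      ultimately have "a \<in> open_segment x b"
        unfolding in_segment by blast
      then show False
        using in_interior_closure_convex_segment[OF \<Omega>(2), of x b] b x out by (auto simp: int)
    qed
    moreover have "\<not> t < inverse p" using inside t b by blast
    ultimately show "b = a" by (simp add: t a_def)
  qed
  show ?thesis
    unfolding exit_point_def p_def[symmetric] a_def[symmetric] by (rule the_equality; fact a uniq)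
qed

lemma funk_eq_ln_ratio:
  fixes \<Omega> :: "'a::euclidean_space set"
  assumes \<Omega>: "open \<Omega>" "convex \<Omega>" and x: "x \<in> \<Omega>" and y: "y \<in> \<Omega>"
    and ray: "\<not> half_line x y \<subseteq> \<Omega>"
  defines "a \<equiv> exit_point \<Omega> x y"
  shows "norm (x - a) / norm (y - a) > 0"
    and "funk \<Omega> x y = ln (norm (x - a) / norm (y - a))"
proof -
  define p where "p = exit_rate \<Omega> x (y - x)"
  have p: "p > 0" "p < 1"
    using exit_rate_nonneg[OF \<Omega>(1) x, of "y - x"] ray exit_rate_chord_less_one[OF \<Omega> x y]
    by (auto simp: half_line_subset_iff[OF \<Omega> x] p_def)
  have "x \<noteq> y" using ray x by (auto simp: half_line_def)
  have a: "a = x + inverse p *\<^sub>R (y - x)"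
    unfolding a_def p_def using p by (intro exit_point_eq \<Omega> x) (simp add: p_def)
  have "x - a = - (inverse p *\<^sub>R (y - x))" by (simp add: a)
  then have nx: "norm (x - a) = inverse p * norm (y - x)" using p by simp
  have "y - a = - ((inverse p - 1) *\<^sub>R (y - x))" by (simp add: a algebra_simps)
  then have "norm (y - a) = \<bar>inverse p - 1\<bar> * norm (y - x)" by (simp only: norm_minus_cancel norm_scaleR)
  moreover have "inverse p > 1" using p by (simp add: one_less_inverse)
  ultimately have ny: "norm (y - a) = (inverse p - 1) * norm (y - x)" by simp
  have eq: "norm (x - a) / norm (y - a) = inverse (1 - p)"
    unfolding nx ny using p \<open>x \<noteq> y\<close> by (simp add: field_simps)
  then show "norm (x - a) / norm (y - a) > 0" using p by simp
  show "funk \<Omega> x y = ln (norm (x - a) / norm (y - a))"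
    unfolding eq funk_def using p by (simp add: ln_inverse p_def)
qed

lemma hilbert_metric_eq_funk:
  fixes \<Omega> :: "'a::euclidean_space set"
  assumes \<Omega>: "open \<Omega>" "convex \<Omega>" and x: "x \<in> \<Omega>" and y: "y \<in> \<Omega>"
  shows "hilbert_metric \<Omega> x y = (funk \<Omega> x y + funk \<Omega> y x) / 2"
proof -
  have zero: "funk \<Omega> z w = 0" if "half_line z w \<subseteq> \<Omega>" "z \<in> \<Omega>" for z w
    using that half_line_subset_iff[OF \<Omega>] by (simp add: funk_def)
  have same: "half_line x y \<subseteq> \<Omega>" "half_line y x \<subseteq> \<Omega>" if "x = y"
    using that x by (auto simp: half_line_def)
  show ?thesis
  proof (cases "half_line x y \<subseteq> \<Omega> \<or> half_line y x \<subseteq> \<Omega>")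
    case True
    then show ?thesis
      using funk_eq_ln_ratio(2)[OF \<Omega> x y] funk_eq_ln_ratio(2)[OF \<Omega> y x] zero[OF _ x] zero[OF _ y] same
      by (auto simp: hilbert_metric_def Let_def)
  next
    case False
    then have "x \<noteq> y" using same by blast
    with False show ?thesis
      using funk_eq_ln_ratio[OF \<Omega> x y] funk_eq_ln_ratio[OF \<Omega> y x]
      by (simp add: hilbert_metric_def Let_def ln_mult_pos del: times_divide_eq_left times_divide_eq_right)
  qed
qed

text \<open>The function \<open>- ln (c - f)\<close> is the potential that calibrates the Funk metric from \<open>x\<close> to \<open>y\<close>.
  The hyperplane \<open>f = c\<close> has to pass through the exit point of the ray: along the segment
  \<open>c - f\<close> is then proportional to the distance to that point, and decreases by the factor
  \<open>1 - exit_rate \<Omega> x (y - x)\<close>.\<close>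

lemma supporting_functional:
  fixes \<Omega> :: "'a::euclidean_space set"
  assumes \<Omega>: "open \<Omega>" "convex \<Omega>" and x: "x \<in> \<Omega>" and y: "y \<in> \<Omega>"
  obtains f c where "\<And>z. z \<in> \<Omega> \<Longrightarrow> f \<bullet> z < c"
    and "funk \<Omega> x y = ln (c - f \<bullet> x) - ln (c - f \<bullet> y)"
proof -
  define p where "p = exit_rate \<Omega> x (y - x)"
  have p: "p \<ge> 0" "p < 1"
    using exit_rate_nonneg[OF \<Omega>(1) x] exit_rate_chord_less_one[OF \<Omega> x y] by (auto simp: p_def)
  have "\<exists>f c. (\<forall>z\<in>\<Omega>. f \<bullet> z < c) \<and> c - f \<bullet> y = (c - f \<bullet> x) * (1 - p)"
  proof (cases "p = 0")
    case True
    \<comment> \<open>The ray stays in \<open>\<Omega>\<close>, the Funk distance vanishes, and a constant potential will do.\<close>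
    then show ?thesis by (intro exI[of _ 0] exI[of _ 1]) simp
  next
    case False
    define a where "a = x + inverse p *\<^sub>R (y - x)"
    have "a \<notin> \<Omega>"
      using mem_iff_exit_rate_less[OF \<Omega> x, of p "y - x"] False p by (simp add: a_def p_def)
    then obtain g b where g: "g \<noteq> 0" "g \<bullet> a \<le> b" "\<forall>z\<in>\<Omega>. b \<le> g \<bullet> z"
      using separating_hyperplane_sets[of "{a}" \<Omega>] \<Omega>(2) x by auto
    \<comment> \<open>Separation is only weak; a step inside the open set \<open>\<Omega>\<close> against \<open>g\<close> makes it strict.\<close>
    have strict: "g \<bullet> a < g \<bullet> z" if "z \<in> \<Omega>" for z
    proof -
      obtain e where e: "e > 0" "z + e *\<^sub>R (- g) \<in> \<Omega>"
        using open_step[OF \<Omega>(1) \<open>z \<in> \<Omega>\<close>] by blast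
      with g have "g \<bullet> a \<le> g \<bullet> z - e * (g \<bullet> g)"
        by (force simp: inner_simps)
      moreover have "e * (g \<bullet> g) > 0" using e g by simp
      ultimately show ?thesis by linarith
    qed
    have "(- g \<bullet> a) - (- g \<bullet> y) = ((- g \<bullet> a) - (- g \<bullet> x)) * (1 - p)"
      using False by (simp add: a_def inner_simps field_simps)
    with strict show ?thesis
      by (intro exI[of _ "- g"] exI[of _ "- g \<bullet> a"]) simp
  qed
  then obtain f c where f: "\<And>z. z \<in> \<Omega> \<Longrightarrow> f \<bullet> z < c" "c - f \<bullet> y = (c - f \<bullet> x) * (1 - p)"
    by blast
  have "funk \<Omega> x y = ln (c - f \<bullet> x) - ln (c - f \<bullet> y)"
    unfolding f(2) funk_def p_def[symmetric] using f(1)[OF x] p by (simp add: ln_mult)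
  with f(1) show thesis using that by blast
qed

text \<open>The motion \<open>z + t v\<close> cannot leave the half-space \<open>f < c\<close> before it leaves \<open>\<Omega>\<close>, and the
  left-hand side, if positive, is the reciprocal of the time at which it leaves that half-space. The
  left-hand side is also the derivative of \<open>- ln (c - f)\<close> at \<open>z\<close> in the direction \<open>v\<close>.\<close>

lemma exit_rate_ge_functional:
  fixes \<Omega> :: "'a::euclidean_space set"
  assumes \<Omega>: "open \<Omega>" "convex \<Omega>" and z: "z \<in> \<Omega>"
    and f: "\<And>w. w \<in> \<Omega> \<Longrightarrow> f \<bullet> w < c"
  shows "f \<bullet> v / (c - f \<bullet> z) \<le> exit_rate \<Omega> z v"
proof (rule ccontr)
  define q where "q = f \<bullet> v / (c - f \<bullet> z)"
  assume "\<not> ?thesis"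
  then have q: "exit_rate \<Omega> z v < q" by (simp add: q_def)
  then have pos: "q > 0" using exit_rate_nonneg[OF \<Omega>(1) z, of v] by linarith
  then have "z + inverse q *\<^sub>R v \<in> \<Omega>" using q mem_iff_exit_rate_less[OF \<Omega> z] by blast
  then have "f \<bullet> z + inverse q * (f \<bullet> v) < c" using f by (metis inner_add_right inner_scaleR_right)
  moreover have "f \<bullet> v = q * (c - f \<bullet> z)" using f[OF z] by (simp add: q_def)
  moreover have "inverse q * (q * (c - f \<bullet> z)) = c - f \<bullet> z" using pos by simp
  ultimately show False by simp
qed

section \<open>Integrating along piecewise continuously differentiable paths\<close>

lemma unit_interval_subdivision:
  fixes T :: "real set"
  assumes T: "finite T" "{0, 1} \<subseteq> T" "T \<subseteq> {0..1}"
  shows "{0..1} = (\<Union>(a, b)\<in>{(a, b). a \<in> T \<and> b \<in> T \<and> a < b \<and> T \<inter> {a<..<b} = {}}. {a..b})"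
    (is "_ = (\<Union>(a, b)\<in>?J. _)")
proof
  show "(\<Union>(a, b)\<in>?J. {a..b}) \<subseteq> {0..1}" using T(3) by force
  show "{0..1} \<subseteq> (\<Union>(a, b)\<in>?J. {a..b})"
  proof
    fix t :: real
    assume t: "t \<in> {0..1}"
    show "t \<in> (\<Union>(a, b)\<in>?J. {a..b})"
    proof (cases "t = 1")
      case True
      let ?A = "T \<inter> {..<1}"
      have A: "finite ?A" "?A \<noteq> {}" using T by auto
      have "s \<notin> T" if "Max ?A < s" "s < 1" for s
        using Max_ge[OF A(1), of s] that by force
      then have "(Max ?A, 1) \<in> ?J" "t \<in> {Max ?A..1}"
        using Max_in[OF A] T(2) True by auto
      then show ?thesis by blast
    next
      case False
      let ?A = "T \<inter> {..t}" and ?B = "T \<inter> {t<..}"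
      have A: "finite ?A" "?A \<noteq> {}" and B: "finite ?B" "?B \<noteq> {}" using T t False by auto
      have "s \<notin> T" if "Max ?A < s" "s < Min ?B" for s
        using Max_ge[OF A(1), of s] Min_le[OF B(1), of s] that by force
      then have "(Max ?A, Min ?B) \<in> ?J" "t \<in> {Max ?A..Min ?B}"
        using Max_in[OF A] Min_in[OF B] by auto
      then show ?thesis by blast
    qed
  qed
qed

text \<open>This is the fundamental theorem of calculus for \<open>g\<close> along the path, followed by discarding the
  negative part of the integrand, which \<^const>\<open>ennreal\<close> sends to zero. The derivative of
  \<open>g \<circ> \<gamma>\<close> is controlled only off the subdivision points, but its continuity up to the ends of each
  piece makes it Lebesgue integrable, so that the gauge integral given by the fundamental theorem
  agrees with the Lebesgue integral.\<close>

lemma ennreal_increment_le_nn_integral: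
  fixes \<gamma> :: "real \<Rightarrow> 'a::real_normed_vector" and g :: "'a \<Rightarrow> real"
  assumes \<gamma>: "piecewise_C1_path \<gamma>" "path_image \<gamma> \<subseteq> \<Omega>"
    and g: "\<And>z. z \<in> \<Omega> \<Longrightarrow> (g has_derivative G z) (at z)"
    and G: "continuous_on (\<Omega> \<times> UNIV) (\<lambda>(z, v). G z v)"
  shows "ennreal (g (\<gamma> 1) - g (\<gamma> 0))
    \<le> (\<integral>\<^sup>+ t\<in>{0..1}. ennreal (G (\<gamma> t) (vector_derivative \<gamma> (at t within {0..1}))) \<partial>lborel)"
proof -
  define h where "h t = G (\<gamma> t) (vector_derivative \<gamma> (at t within {0..1}))" for t
  obtain T where T: "finite T" "{0, 1} \<subseteq> T" "T \<subseteq> {0..1}"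
    and pieces: "\<forall>a\<in>T. \<forall>b\<in>T. a < b \<and> T \<inter> {a<..<b} = {} \<longrightarrow>
           (\<exists>\<gamma>'. continuous_on {a..b} \<gamma>' \<and>
              (\<forall>t\<in>{a..b}. (\<gamma> has_vector_derivative \<gamma>' t) (at t within {a..b})))"
    using \<gamma>(1) unfolding piecewise_C1_path_def by blast
  define J where "J = {(a, b). a \<in> T \<and> b \<in> T \<and> a < b \<and> T \<inter> {a<..<b} = {}}"
  have UJ: "{0..1} = (\<Union>j\<in>J. {fst j..snd j})"
    using unit_interval_subdivision[OF T] by (auto simp: J_def case_prod_beta)
  have finJ: "finite J"
    by (rule finite_subset[of _ "T \<times> T"]) (auto simp: J_def T)
  have in_\<Omega>: "\<gamma> t \<in> \<Omega>" if "t \<in> {0..1}" for t using \<gamma>(2) that by (auto simp: path_image_def)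
  have piece: "continuous_on {a..b} \<gamma> \<and> set_integrable lborel {a<..<b} h \<and>
      (\<forall>t\<in>{a<..<b}. ((g \<circ> \<gamma>) has_vector_derivative h t) (at t))" if ab: "(a, b) \<in> J" for a b
  proof -
    obtain \<gamma>' where \<gamma>': "continuous_on {a..b} \<gamma>'"
        "\<And>t. t \<in> {a..b} \<Longrightarrow> (\<gamma> has_vector_derivative \<gamma>' t) (at t within {a..b})"
      using pieces ab unfolding J_def by blast
    have sub: "{a..b} \<subseteq> {0..1}" using ab T(3) by (auto simp: J_def)
    have cont: "continuous_on {a..b} \<gamma>"
      using \<gamma>'(2) by (meson continuous_on_eq_continuous_within has_vector_derivative_continuous)
    have at: "(\<gamma> has_vector_derivative \<gamma>' t) (at t)" if "t \<in> {a<..<b}" for t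
      using \<gamma>'(2)[of t] that by (metis at_within_Icc_at greaterThanLessThan_iff atLeastAtMost_iff less_imp_le)
    have h: "h t = G (\<gamma> t) (\<gamma>' t)" if "t \<in> {a<..<b}" for t
      using vector_derivative_at_within_ivl[OF at[OF that], of 0 1] that sub by (force simp: h_def)
    have "continuous_on {a..b} (\<lambda>t. (\<lambda>(z, v). G z v) (\<gamma> t, \<gamma>' t))"
      by (intro continuous_on_compose2[OF G] continuous_intros cont \<gamma>') (use sub in_\<Omega> in auto)
    then have "set_integrable lborel {a..b} (\<lambda>t. G (\<gamma> t) (\<gamma>' t))"
      by (intro borel_integrable_atLeastAtMost') simp
    then have "set_integrable lborel {a<..<b} (\<lambda>t. G (\<gamma> t) (\<gamma>' t))"
      by (rule set_integrable_subset) auto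
    then have "set_integrable lborel {a<..<b} h"
      by (subst set_integrable_cong[OF refl refl h])
    moreover have "((g \<circ> \<gamma>) has_vector_derivative h t) (at t)" if "t \<in> {a<..<b}" for t
    proof -
      have gt: "(g has_derivative G (\<gamma> t)) (at (\<gamma> t))"
        using that sub by (intro g in_\<Omega>) auto
      then have "linear (G (\<gamma> t))" by (rule has_derivative_linear)
      moreover have "((g \<circ> \<gamma>) has_derivative (G (\<gamma> t) \<circ> (\<lambda>s. s *\<^sub>R \<gamma>' t))) (at t)"
        using at[OF that] gt unfolding has_vector_derivative_def by (rule diff_chain_at)
      ultimately show ?thesis
        by (simp add: has_vector_derivative_def h[OF that] o_def linear_scale)
    qed
    ultimately show ?thesis using cont by blast
  qed
  have "set_integrable lborel (\<Union>j\<in>J. {fst j<..<snd j}) h"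
    using piece by (intro set_integrable_UN finJ) auto
  moreover have "((\<Union>j\<in>J. {fst j<..<snd j}) - {0..1}) \<union> ({0..1} - (\<Union>j\<in>J. {fst j<..<snd j})) \<subseteq> T"
  proof -
    have "{fst j<..<snd j} \<subseteq> {0..1}" if "j \<in> J" for j
      unfolding UJ using that by (intro UN_upper[THEN order_trans[rotated]]) auto
    moreover have "t \<in> T" if t: "t \<in> {0..1}" "t \<notin> (\<Union>j\<in>J. {fst j<..<snd j})" for t
    proof -
      obtain j where j: "j \<in> J" "t \<in> {fst j..snd j}" using t(1) unfolding UJ by blast
      moreover have "t \<notin> {fst j<..<snd j}" using j(1) t(2) by blast
      ultimately have "t = fst j \<or> t = snd j" by auto
      then show ?thesis using j(1) by (auto simp: J_def)
    qed
    ultimately show ?thesis by blast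
  qed
  ultimately have int: "set_integrable lborel {0..1} h"
    using set_integrable_discrete_difference[of T "\<Union>j\<in>J. {fst j<..<snd j}" "{0..1}" lborel h]
      countable_finite[OF T(1)] by simp
  have "continuous_on {0..1} \<gamma>"
    unfolding UJ using piece by (intro continuous_on_closed_Union finJ) auto
  moreover have "continuous_on \<Omega> g"
    using g by (meson continuous_at_imp_continuous_on has_derivative_continuous)
  ultimately have "continuous_on {0..1} (g \<circ> \<gamma>)"
    using in_\<Omega> by (intro continuous_on_compose) (auto elim!: continuous_on_subset)
  moreover have "((g \<circ> \<gamma>) has_vector_derivative h t) (at t)" if "t \<in> {0<..<1} - T" for t
  proof -
    have "t \<in> (\<Union>j\<in>J. {fst j..snd j})" using that unfolding UJ[symmetric] by auto
    then obtain a b where "(a, b) \<in> J" "t \<in> {a..b}" by auto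
    moreover from this have "t \<in> {a<..<b}" using that by (auto simp: J_def less_le)
    ultimately show ?thesis using piece by blast
  qed
  ultimately have "(h has_integral (g \<circ> \<gamma>) 1 - (g \<circ> \<gamma>) 0) {0..1}"
    by (intro fundamental_theorem_of_calculus_interior_strong[OF T(1)]) (simp_all add: o_def)
  then have "g (\<gamma> 1) - g (\<gamma> 0) = (LINT t:{0..1}|lborel. h t)"
    using set_borel_integral_eq_integral(2)[OF int] by (simp add: integral_unique)
  also have "\<dots> \<le> (LINT t|lborel. max 0 (indicator {0..1} t *\<^sub>R h t))"
    unfolding set_lebesgue_integral_def
    using int by (intro integral_mono integrable_max) (auto simp: set_integrable_def)
  finally have "ennreal (g (\<gamma> 1) - g (\<gamma> 0)) \<le> ennreal (LINT t|lborel. max 0 (indicator {0..1} t *\<^sub>R h t))"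
    by (rule ennreal_leI)
  also have "\<dots> = (\<integral>\<^sup>+ t. ennreal (max 0 (indicator {0..1} t *\<^sub>R h t)) \<partial>lborel)"
    using int by (intro nn_integral_eq_integral[symmetric] integrable_max) (auto simp: set_integrable_def)
  also have "\<dots> = (\<integral>\<^sup>+ t\<in>{0..1}. ennreal (h t) \<partial>lborel)"
    by (intro nn_integral_cong) (auto simp: indicator_def max_def ennreal_neg)
  finally show ?thesis by (simp add: h_def)
qed

section \<open>Lengths of paths\<close>

text \<open>The calibrating potential is half the difference of the potentials for the rays from
  \<open>\<gamma> 0\<close> through \<open>\<gamma> 1\<close> and back. The second one enters with the opposite sign because it bounds the
  exit rate in the direction \<open>- v\<close>.\<close>

lemma hilbert_metric_le_finsler_length:
  fixes \<Omega> :: "'a::euclidean_space set"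
  assumes \<Omega>: "open \<Omega>" "convex \<Omega>"
    and \<gamma>: "piecewise_C1_path \<gamma>" "path_image \<gamma> \<subseteq> \<Omega>"
  shows "ennreal (hilbert_metric \<Omega> (\<gamma> 0) (\<gamma> 1)) \<le> finsler_length (reversible_tautological \<Omega>) \<gamma>"
proof -
  have in_\<Omega>: "\<gamma> t \<in> \<Omega>" if "t \<in> {0..1}" for t using \<gamma>(2) that by (auto simp: path_image_def)
  have ends: "\<gamma> 0 \<in> \<Omega>" "\<gamma> 1 \<in> \<Omega>" using in_\<Omega> by auto
  obtain f c where f: "\<And>z. z \<in> \<Omega> \<Longrightarrow> f \<bullet> z < c"
    and F: "funk \<Omega> (\<gamma> 0) (\<gamma> 1) = ln (c - f \<bullet> \<gamma> 0) - ln (c - f \<bullet> \<gamma> 1)"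
    using supporting_functional[OF \<Omega> ends] by blast
  obtain k d where k: "\<And>z. z \<in> \<Omega> \<Longrightarrow> k \<bullet> z < d"
    and K: "funk \<Omega> (\<gamma> 1) (\<gamma> 0) = ln (d - k \<bullet> \<gamma> 1) - ln (d - k \<bullet> \<gamma> 0)"
    using supporting_functional[OF \<Omega> ends(2,1)] by blast
  define g where "g z = (ln (d - k \<bullet> z) - ln (c - f \<bullet> z)) / 2" for z
  define G where "G z v = (f \<bullet> v / (c - f \<bullet> z) + k \<bullet> (- v) / (d - k \<bullet> z)) / 2" for z v
  have ln_deriv: "((\<lambda>z. ln (b - l \<bullet> z)) has_derivative (\<lambda>v. - (l \<bullet> v) / (b - l \<bullet> z))) (at z)"
    if "l \<bullet> z < b" for l z :: 'a and b
    using that by (auto intro!: derivative_eq_intros simp: field_simps)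
  have deriv: "(g has_derivative G z) (at z)" if "z \<in> \<Omega>" for z
  proof -
    have "(g has_derivative (\<lambda>v. (- (k \<bullet> v) / (d - k \<bullet> z) - - (f \<bullet> v) / (c - f \<bullet> z)) / 2)) (at z)"
      unfolding g_def
      by (intro bounded_linear.has_derivative[OF bounded_linear_divide] has_derivative_diff
          ln_deriv f k that)
    then show ?thesis by (simp add: G_def[abs_def])
  qed
  have cont: "continuous_on (\<Omega> \<times> UNIV) (\<lambda>(z, v). G z v)"
    unfolding G_def case_prod_beta using f k
    by (intro continuous_intros) (auto simp: less_imp_neq[THEN not_sym])
  have "hilbert_metric \<Omega> (\<gamma> 0) (\<gamma> 1) = g (\<gamma> 1) - g (\<gamma> 0)"
    unfolding hilbert_metric_eq_funk[OF \<Omega> ends] F K by (simp add: g_def field_simps)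
  then have "ennreal (hilbert_metric \<Omega> (\<gamma> 0) (\<gamma> 1))
      \<le> (\<integral>\<^sup>+ t\<in>{0..1}. ennreal (G (\<gamma> t) (vector_derivative \<gamma> (at t within {0..1}))) \<partial>lborel)"
    using ennreal_increment_le_nn_integral[OF \<gamma> deriv cont] by simp
  also have "\<dots> \<le> finsler_length (reversible_tautological \<Omega>) \<gamma>"
    unfolding finsler_length_def
  proof (rule nn_integral_mono)
    fix t :: real
    let ?v = "vector_derivative \<gamma> (at t within {0..1})"
    show "ennreal (G (\<gamma> t) ?v) * indicator {0..1} t
      \<le> lagrangian (reversible_tautological \<Omega>) (\<gamma> t) ?v * indicator {0..1} t"
    proof (cases "t \<in> {0..1}")
      case True
      then show ?thesis
        using exit_rate_ge_functional[OF \<Omega> in_\<Omega>[OF True] f, of ?v]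
          exit_rate_ge_functional[OF \<Omega> in_\<Omega>[OF True] k, of "- ?v"]
        unfolding lagrangian_reversible_tautological[OF \<Omega> in_\<Omega>[OF True]] G_def
        by (intro mult_right_mono ennreal_leI divide_right_mono add_mono) simp_all
    qed simp
  qed
  finally show ?thesis .
qed

lemma piecewise_C1_path_linepath: "piecewise_C1_path (linepath x y)"
  unfolding piecewise_C1_path_def
  by (rule exI[of _ "{0, 1}"])
    (auto intro!: exI[of _ "\<lambda>_. y - x"] has_vector_derivative_linepath_within)

text \<open>In the direction \<open>y - x\<close> the exit rate is obtained by moving a time \<open>t\<close> from \<open>x\<close>, in the
  direction \<open>x - y\<close> by moving a time \<open>1 - t\<close> from \<open>y\<close>; an antiderivative of the resulting Lagrangian
  has increment \<open>(funk \<Omega> x y + funk \<Omega> y x) / 2\<close>.\<close>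

lemma finsler_length_linepath:
  fixes \<Omega> :: "'a::euclidean_space set"
  assumes \<Omega>: "open \<Omega>" "convex \<Omega>" and x: "x \<in> \<Omega>" and y: "y \<in> \<Omega>"
  shows "finsler_length (reversible_tautological \<Omega>) (linepath x y) = ennreal (hilbert_metric \<Omega> x y)"
proof -
  define p where "p = exit_rate \<Omega> x (y - x)"
  define q where "q = exit_rate \<Omega> y (x - y)"
  have p: "p \<ge> 0" "p < 1" and q: "q \<ge> 0" "q < 1"
    using exit_rate_nonneg[OF \<Omega>(1)] exit_rate_chord_less_one[OF \<Omega>] x y by (auto simp: p_def q_def)
  have pos: "1 - t * p > 0" "1 - (1 - t) * q > 0" if "t \<in> {0..1}" for t
    using that p q mult_left_le_one_le[of p t] mult_left_le_one_le[of q "1 - t"] by auto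
  define \<Phi> where "\<Phi> t = (ln (1 - (1 - t) * q) - ln (1 - t * p)) / 2" for t
  define \<phi> where "\<phi> t = (p / (1 - t * p) + q / (1 - (1 - t) * q)) / 2" for t
  have L: "lagrangian (reversible_tautological \<Omega>) (linepath x y t) (y - x) = ennreal (\<phi> t)"
    if t: "t \<in> {0..1}" for t
  proof -
    have 1: "linepath x y t = x + t *\<^sub>R (y - x)" and 2: "linepath x y t = y + (1 - t) *\<^sub>R (x - y)"
      by (simp_all add: linepath_def algebra_simps)
    have mem: "linepath x y t \<in> \<Omega>"
      using convex_contains_segment[of \<Omega>] \<Omega>(2) x y linepath_in_path[OF t] by blast
    have "exit_rate \<Omega> (linepath x y t) (y - x) = p / (1 - t * p)"
      using exit_rate_along_line(2)[OF \<Omega> x, of t "y - x"] t mem by (simp add: p_def 1)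
    moreover have "exit_rate \<Omega> (linepath x y t) (x - y) = q / (1 - (1 - t) * q)"
      using exit_rate_along_line(2)[OF \<Omega> y, of "1 - t" "x - y"] t mem by (simp add: q_def 2)
    ultimately show ?thesis
      by (simp add: lagrangian_reversible_tautological[OF \<Omega> mem] \<phi>_def)
  qed
  have "finsler_length (reversible_tautological \<Omega>) (linepath x y)
      = (\<integral>\<^sup>+ t. ennreal (\<phi> t) * indicator {0..1} t \<partial>lborel)"
    unfolding finsler_length_def
    by (intro nn_integral_cong) (simp add: indicator_def vector_derivative_linepath_within L)
  also have "\<dots> = ennreal (\<Phi> 1 - \<Phi> 0)"
  proof (rule nn_integral_FTC_Icc)
    show "\<phi> \<in> borel_measurable borel" unfolding \<phi>_def by measurable
    show "DERIV \<Phi> t :> \<phi> t" if "t \<in> {0..1}" for t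
    proof -
      have "DERIV (\<lambda>t. ln (1 - t * p)) t :> - p / (1 - t * p)"
        "DERIV (\<lambda>t. ln (1 - (1 - t) * q)) t :> q / (1 - (1 - t) * q)"
        using pos[OF that] by (auto intro!: derivative_eq_intros)
      then have "DERIV \<Phi> t :> (q / (1 - (1 - t) * q) - - p / (1 - t * p)) / 2"
        unfolding \<Phi>_def by (intro DERIV_cdivide DERIV_diff)
      then show ?thesis by (simp add: \<phi>_def add.commute)
    qed
    show "0 \<le> \<phi> t" if "t \<in> {0..1}" for t
      unfolding \<phi>_def using pos[OF that] p q by (intro divide_nonneg_nonneg add_nonneg_nonneg) auto
  qed simp
  also have "\<Phi> 1 - \<Phi> 0 = hilbert_metric \<Omega> x y"
    unfolding hilbert_metric_eq_funk[OF \<Omega> x y] funk_def by (simp add: \<Phi>_def p_def q_def)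
  finally show ?thesis .
qed

theorem theorem3:
  fixes \<Omega> :: "(real ^ 'n) set"
  assumes "\<Omega> \<noteq> {}" and "open \<Omega>" and "convex \<Omega>"
  shows "(\<forall>x\<in>\<Omega>. \<forall>y\<in>\<Omega>.
            enn2ereal (finsler_dist \<Omega> (reversible_tautological \<Omega>) x y)
              = ereal (hilbert_metric \<Omega> x y)) \<and>
         (\<forall>x\<in>\<Omega>. \<forall>y\<in>\<Omega>.
            enn2ereal (finsler_length (reversible_tautological \<Omega>) (linepath x y))
              = ereal (hilbert_metric \<Omega> x y))"
proof -
  note \<Omega> = assms(2,3)
  have nonneg: "hilbert_metric \<Omega> x y \<ge> 0" if "x \<in> \<Omega>" "y \<in> \<Omega>" for x y
    using that by (simp add: hilbert_metric_eq_funk[OF \<Omega>] funk_nonneg[OF \<Omega>])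
  have "finsler_dist \<Omega> (reversible_tautological \<Omega>) x y = ennreal (hilbert_metric \<Omega> x y)"
    if xy: "x \<in> \<Omega>" "y \<in> \<Omega>" for x y
  proof (rule antisym)
    have "path_image (linepath x y) \<subseteq> \<Omega>"
      using \<Omega>(2) xy by (simp add: closed_segment_subset)
    then show "finsler_dist \<Omega> (reversible_tautological \<Omega>) x y \<le> ennreal (hilbert_metric \<Omega> x y)"
      unfolding finsler_length_linepath[OF \<Omega> xy, symmetric] finsler_dist_def
      by (intro INF_lower) (simp add: piecewise_C1_path_linepath)
    show "ennreal (hilbert_metric \<Omega> x y) \<le> finsler_dist \<Omega> (reversible_tautological \<Omega>) x y"
      unfolding finsler_dist_def using hilbert_metric_le_finsler_length[OF \<Omega>]
      by (intro INF_greatest) (auto simp: pathstart_def pathfinish_def)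
  qed
  then show ?thesis
    using finsler_length_linepath[OF \<Omega>] nonneg by (simp add: enn2ereal_ennreal)
qed

end
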